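(* Let $(G,c,r)$ be a connected, locally finite weighted graph with $G=(\mathcal{V},\mathcal{E})$, and let $D=\mathrm{d}+\delta$ be its Gauss-Bonnet operator on $\mathcal{C}_0(\mathcal{V})\oplus\mathcal{C}^a_0(\mathcal{E})$. Let $W$ be a Hilbert space satisfying: (1) $\mathcal{C}_{0}(\mathcal{V})\oplus\mathcal{C}^{a}_{0}(\mathcal{E})$ is (a linear subspace of $W$ which is) dense in $W$; (2) the inclusion of $\mathcal{C}_{0}(\mathcal{V})\oplus\mathcal{C}^{a}_{0}(\mathcal{E})$ into $\mathcal{C}(\mathcal{V})\oplus\mathcal{C}^{a}(\mathcal{E})$ (with the topology of pointwise convergence) extends by continuity to a continuous linear injection of $W$ into $\mathcal{C}(\mathcal{V})\oplus\mathcal{C}^{a}(\mathcal{E})$; (3) $D$ extends to a bounded operator $D:W\to l^{2}(G)$. If there exist a finite subgraph $G_K=(K,\mathcal{E}_K)$ of $G$ and a constant $C=C_K>0$ such that $$C\,\|(f,\varphi)\|_{W}\le \|D(f,\varphi)\|_{l^{2}(G)}\qquad\text{for all }(f,\varphi)\in\mathcal{C}_{0}(\mathcal{V}\setminus K)\times\mathcal{C}^{a}_{0}(\mathcal{E}\setminus\mathcal{E}_{K}),$$ then the operator $D:W\to l^{2}(G)$ is semi-Fredholm.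
   Context: A graph $G=(\mathcal{V},\mathcal{E})$ consists of an at most countable set $\mathcal{V}$ of vertices and a set $\mathcal{E}\subset\mathcal{V}\times\mathcal{V}$ of oriented edges which is symmetric ($(x,y)\in\mathcal{E}\Rightarrow(y,x)\in\mathcal{E}$) and has no loops. For $e=(x,y)$ write $e^-=x$, $e^+=y$, $-e=(y,x)$. $G$ is locally finite if each vertex is the origin of finitely many edges. A weighted graph $(G,c,r)$ has weights $c:\mathcal{V}\to(0,\infty)$ and $r:\mathcal{E}\to(0,\infty)$ with $r(-e)=r(e)$. For $K\subset\mathcal{V}$, the subgraph $G_K=(K,\mathcal{E}_K)$ has $\mathcal{E}_K=\{e\in\mathcal{E}: e^-,e^+\in K\}$; it is finite if $K$ is finite. $\mathcal{C}(\mathcal{V})$ is the space of functions $f:\mathcal{V}\to\mathbb{R}$; $\mathcal{C}^a(\mathcal{E})$ is the space of functions $\varphi:\mathcal{E}\to\mathbb{R}$ with $\varphi(-e)=-\varphi(e)$; $\mathcal{C}_0(\mathcal{V})$ and $\mathcal{C}^a_0(\mathcal{E})$ are the subspaces of finitely supported functions. $\mathcal{C}_0(\mathcal{V}\setminus K)$ and $\mathcal{C}^a_0(\mathcal{E}\setminus\mathcal{E}_K)$ denote the finitely supported functions on $\mathcal V$ (resp. skewsymmetric on $\mathcal E$) with support in $\mathcal{V}\setminus K$ (resp. $\mathcal{E}\setminus\mathcal{E}_K$). $l^2(\mathcal{V})$ has norm $\|f\|^2_{l^2(\mathcal V)}=\sum_{x\in\mathcal{V}}c(x)f(x)^2$,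 $l^2(\mathcal{E})\subset \mathcal{C}^a(\mathcal{E})$ has norm $\|\varphi\|^2_{l^2(\mathcal E)}=\frac12\sum_{e\in\mathcal{E}}r(e)\varphi(e)^2$, and $l^2(G)=l^2(\mathcal{V})\oplus l^2(\mathcal{E})$ with $\|(f,\varphi)\|^2_{l^2(G)}=\|f\|^2_{l^2(\mathcal V)}+\|\varphi\|^2_{l^2(\mathcal E)}$. $\mathrm{d}f(e)=f(e^+)-f(e^-)$ and $\delta\varphi(x)=\frac{1}{c(x)}\sum_{e:\,e^+=x}r(e)\varphi(e)$. The Gauss-Bonnet operator is $D(f,\varphi)=(\delta\varphi,\mathrm{d}f)$ on $\mathcal{C}_0(\mathcal{V})\oplus\mathcal{C}^a_0(\mathcal{E})$. A bounded operator is called semi-Fredholm if its range is closed and its kernel is finite dimensional. *)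

theory Defs
  imports
    "HOL-Analysis.Analysis"
    "HOL-Library.Function_Algebras"
    "Graph_Theory.Digraph_Component"
begin

section \<open>The pointwise real vector space structure on functions\<close>

instantiation "fun" :: (type, scaleR) scaleR
begin
definition scaleR_fun_def: "a *\<^sub>R f = (\<lambda>x. a *\<^sub>R f x)"
instance ..
end

lemma scaleR_fun_apply [simp]: "(a *\<^sub>R f) x = a *\<^sub>R f x"
  by (simp add: scaleR_fun_def)

instance "fun" :: (type, real_vector) real_vector
  by standard (simp_all add: fun_eq_iff scaleR_add_right scaleR_add_left)

definition linear_on ::
  "'a::real_vector set \<Rightarrow> ('a \<Rightarrow> 'b::real_vector) \<Rightarrow> bool" where
  "linear_on S f \<longleftrightarrow> (\<forall>u\<in>S. \<forall>v\<in>S. f (u + v) = f u + f v) \<and> (\<forall>a. \<forall>u\<in>S. f (a *\<^sub>R u) = a *\<^sub>R f u)"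


section \<open>Weighted graphs\<close>

text \<open>An edge is a pair \<open>e = (x, y)\<close> with \<open>e\<^sup>- = fst e\<close>, \<open>e\<^sup>+ = snd e\<close> and
  \<open>-e = prod.swap e\<close>. The locale \<^locale>\<open>pair_bidirected_digraph\<close> says that the edge set is
  symmetric, without loops, and contained in the square of the vertex set; the graph may
  be infinite.\<close>

locale weighted_graph = pair_bidirected_digraph G
  for G :: "'v pair_pre_digraph" +
  fixes c :: "'v \<Rightarrow> real" and r :: "'v \<times> 'v \<Rightarrow> real"
  assumes countable_verts: "countable (pverts G)"
    and c_pos: "x \<in> pverts G \<Longrightarrow> 0 < c x"
    and r_pos: "e \<in> parcs G \<Longrightarrow> 0 < r e"
    and r_swap: "e \<in> parcs G \<Longrightarrow> r (prod.swap e) = r e"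

definition locally_finite_graph :: "'v pair_pre_digraph \<Rightarrow> bool" where
  "locally_finite_graph G \<longleftrightarrow> (\<forall>x\<in>pverts G. finite (out_arcs (with_proj G) x))"

definition edges_within :: "'v pair_pre_digraph \<Rightarrow> 'v set \<Rightarrow> ('v \<times> 'v) set" where
  "edges_within G K = arcs (with_proj G \<restriction> K)"


section \<open>Function spaces\<close>

text \<open>A function on the vertex (edge) set is represented by the total function that extends
  it by zero. The product topology on total functions then induces the topology of pointwise
  convergence.\<close>

type_synonym 'v cochain = "('v \<Rightarrow> real) \<times> ('v \<times> 'v \<Rightarrow> real)"

definition vertex_functions :: "'v pair_pre_digraph \<Rightarrow> ('v \<Rightarrow> real) set" where
  "vertex_functions G = {f. {x. f x \<noteq> 0} \<subseteq> pverts G}"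

definition edge_functions :: "'v pair_pre_digraph \<Rightarrow> ('v \<times> 'v \<Rightarrow> real) set" where
  "edge_functions G =
    {\<phi>. {e. \<phi> e \<noteq> 0} \<subseteq> parcs G \<and> (\<forall>e\<in>parcs G. \<phi> (prod.swap e) = - \<phi> e)}"

definition vertex_functions0 :: "'v pair_pre_digraph \<Rightarrow> 'v set \<Rightarrow> ('v \<Rightarrow> real) set" where
  "vertex_functions0 G A = {f \<in> vertex_functions G. finite {x. f x \<noteq> 0} \<and> {x. f x \<noteq> 0} \<subseteq> A}"

definition edge_functions0 ::
  "'v pair_pre_digraph \<Rightarrow> ('v \<times> 'v) set \<Rightarrow> ('v \<times> 'v \<Rightarrow> real) set" where
  "edge_functions0 G B = {\<phi> \<in> edge_functions G. finite {e. \<phi> e \<noteq> 0} \<and> {e. \<phi> e \<noteq> 0} \<subseteq> B}"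

definition cochains :: "'v pair_pre_digraph \<Rightarrow> 'v cochain set" where
  "cochains G = vertex_functions G \<times> edge_functions G"

definition cochains0 :: "'v pair_pre_digraph \<Rightarrow> 'v cochain set" where
  "cochains0 G = vertex_functions0 G (pverts G) \<times> edge_functions0 G (parcs G)"

definition cochains0_outside :: "'v pair_pre_digraph \<Rightarrow> 'v set \<Rightarrow> 'v cochain set" where
  "cochains0_outside G K =
    vertex_functions0 G (pverts G - K) \<times> edge_functions0 G (parcs G - edges_within G K)"


section \<open>The space of square-summable cochains\<close>

definition l2 ::
  "'v pair_pre_digraph \<Rightarrow> ('v \<Rightarrow> real) \<Rightarrow> ('v \<times> 'v \<Rightarrow> real) \<Rightarrow> 'v cochain set" where
  "l2 G c r = {(f, \<phi>) \<in> cochains G.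
    (\<lambda>x. c x * (f x)\<^sup>2) summable_on pverts G \<and> (\<lambda>e. r e * (\<phi> e)\<^sup>2) summable_on parcs G}"

fun l2_norm ::
  "'v pair_pre_digraph \<Rightarrow> ('v \<Rightarrow> real) \<Rightarrow> ('v \<times> 'v \<Rightarrow> real) \<Rightarrow> 'v cochain \<Rightarrow> real" where
  "l2_norm G c r (f, \<phi>) = sqrt
    ((\<Sum>\<^sub>\<infinity>x\<in>pverts G. c x * (f x)\<^sup>2) + 1 / 2 * (\<Sum>\<^sub>\<infinity>e\<in>parcs G. r e * (\<phi> e)\<^sup>2))"

context weighted_graph
begin

lemma diff_cochains: "u \<in> cochains G \<Longrightarrow> v \<in> cochains G \<Longrightarrow> u - v \<in> cochains G"
proof -
  assume u: "u \<in> cochains G" and v: "v \<in> cochains G"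
  have 1: "fst u x - fst v x = 0" if "x \<notin> pverts G" for x
    using u v that by (force simp: cochains_def vertex_functions_def)
  have 2: "snd u e - snd v e = 0" if "e \<notin> parcs G" for e
    using u v that by (force simp: cochains_def edge_functions_def)
  have 3: "snd (u - v) (prod.swap e) = - snd (u - v) e" if "e \<in> parcs G" for e
    using u v that by (simp add: cochains_def edge_functions_def mem_Times_iff)
  show ?thesis
    unfolding cochains_def vertex_functions_def edge_functions_def mem_Times_iff
    using 1 2 3 by (auto simp del: right_minus_eq)
qed

lemma weighted_sum_bound:
  fixes a :: "'b \<Rightarrow> real"
  assumes "\<And>x. x \<in> A \<Longrightarrow> 0 \<le> a x"
    and "(\<lambda>x. a x * (f x)\<^sup>2) summable_on A" "(\<lambda>x. a x * (g x)\<^sup>2) summable_on A"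
  shows "(\<lambda>x. a x * (f x - g x)\<^sup>2) summable_on A"
proof (rule summable_on_comparison_test)
  show "(\<lambda>x. 2 * (a x * (f x)\<^sup>2 + a x * (g x)\<^sup>2)) summable_on A"
    using assms by (intro summable_on_cmult_right summable_on_add)
  fix x assume x: "x \<in> A"
  have "(f x - g x)\<^sup>2 \<le> 2 * ((f x)\<^sup>2 + (g x)\<^sup>2)"
    using zero_le_power2[of "f x + g x"] by (simp add: power2_eq_square algebra_simps)
  from mult_left_mono[OF this assms(1)[OF x]]
  show "a x * (f x - g x)\<^sup>2 \<le> 2 * (a x * (f x)\<^sup>2 + a x * (g x)\<^sup>2)" by (simp add: algebra_simps)
  show "0 \<le> a x * (f x - g x)\<^sup>2" using assms(1)[OF x] by simp
qed

lemma diff_l2: "u \<in> l2 G c r \<Longrightarrow> v \<in> l2 G c r \<Longrightarrow> u - v \<in> l2 G c r"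
  using diff_cochains[of u v] weighted_sum_bound[of "pverts G" c "fst u" "fst v"]
    weighted_sum_bound[of "parcs G" r "snd u" "snd v"] c_pos r_pos
  by (cases u; cases v) (auto simp: l2_def less_imp_le minus_prod_def)

lemma l2_norm_nonneg: "0 \<le> l2_norm G c r u"
  by (cases u) (auto intro!: add_nonneg_nonneg infsum_nonneg mult_nonneg_nonneg simp: less_imp_le c_pos r_pos)

lemma l2_norm_eq_0: assumes "u \<in> l2 G c r" "l2_norm G c r u = 0" shows "u = 0"
proof -
  obtain f \<phi> where u: "u = (f, \<phi>)" by fastforce
  let ?a = "\<Sum>\<^sub>\<infinity>x\<in>pverts G. c x * (f x)\<^sup>2" and ?b = "\<Sum>\<^sub>\<infinity>e\<in>parcs G. r e * (\<phi> e)\<^sup>2"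
  have nn: "?a \<ge> 0" "?b \<ge> 0" 
    by (auto intro!: infsum_nonneg mult_nonneg_nonneg simp: less_imp_le c_pos r_pos)
  with assms u have z: "?a = 0" "?b = 0" by (auto simp: add_nonneg_eq_0_iff)
  have s: "(\<lambda>x. c x * (f x)\<^sup>2) summable_on pverts G" "(\<lambda>e. r e * (\<phi> e)\<^sup>2) summable_on parcs G"
    using assms u by (auto simp: l2_def)
  have "f x = 0" for x
  proof (cases "x \<in> pverts G")
    case True
    have "c x * (f x)\<^sup>2 = 0"
      using nonneg_infsum_le_0D[of "\<lambda>x. c x * (f x)\<^sup>2" "pverts G" x] z s c_pos True by (simp add: less_imp_le)
    with c_pos[OF True] show ?thesis by simp
  qed (use assms u in \<open>auto simp: l2_def cochains_def vertex_functions_def\<close>)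
  moreover have "\<phi> x = 0" for x
  proof (cases "x \<in> parcs G")
    case True
    have "r x * (\<phi> x)\<^sup>2 = 0"
      using nonneg_infsum_le_0D[of "\<lambda>x. r x * (\<phi> x)\<^sup>2" "parcs G" x] z s r_pos True by (simp add: less_imp_le)
    with r_pos[OF True] show ?thesis by simp
  qed (use assms u in \<open>auto simp: l2_def cochains_def edge_functions_def\<close>)
  ultimately show ?thesis by (auto simp: u zero_prod_def fun_eq_iff)
qed

lemma l2_norm_L2_set:
  assumes "u \<in> l2 G c r"
    and h_def: "\<And>u. h u = case_sum (\<lambda>x. sqrt (c x) * fst u x) (\<lambda>e. sqrt (r e / 2) * snd u e)"
  shows "((\<lambda>i. (h u i)\<^sup>2) has_sum (l2_norm G c r u)\<^sup>2) (pverts G <+> parcs G)"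
proof -
  obtain f \<phi> where u: "u = (f, \<phi>)" by fastforce
  have s: "(\<lambda>x. c x * (f x)\<^sup>2) summable_on pverts G" "(\<lambda>e. r e * (\<phi> e)\<^sup>2) summable_on parcs G"
    using assms u by (auto simp: l2_def)
  have nn: "(\<Sum>\<^sub>\<infinity>x\<in>pverts G. c x * (f x)\<^sup>2) \<ge> 0" "(\<Sum>\<^sub>\<infinity>e\<in>parcs G. r e * (\<phi> e)\<^sup>2) \<ge> 0" 
    by (auto intro!: infsum_nonneg mult_nonneg_nonneg simp: less_imp_le c_pos r_pos)
  have 1: "((\<lambda>i. (h u i)\<^sup>2) has_sum (\<Sum>\<^sub>\<infinity>x\<in>pverts G. c x * (f x)\<^sup>2)) (Inl ` pverts G)"
    unfolding has_sum_reindex[OF inj_Inl[THEN inj_on_subset[OF _ subset_UNIV]]]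
    using has_sum_infsum[OF s(1)]
    by (rule has_sum_cong[THEN iffD1, rotated]) (simp add: u h_def power_mult_distrib c_pos less_imp_le)
  have 2: "((\<lambda>i. (h u i)\<^sup>2) has_sum (1/2 * (\<Sum>\<^sub>\<infinity>x\<in>parcs G. r x * (\<phi> x)\<^sup>2))) (Inr ` parcs G)"
    unfolding has_sum_reindex[OF inj_Inr[THEN inj_on_subset[OF _ subset_UNIV]]]
    using has_sum_cmult_right[OF has_sum_infsum[OF s(2)], of "1/2"]
    by (rule has_sum_cong[THEN iffD1, rotated]) (simp add: u h_def power_mult_distrib r_pos less_imp_le)
  show ?thesis
    using has_sum_Un_disjoint[OF 1 2] nn by (auto simp: u Plus_def)
qed

lemma l2_norm_triangle:
  assumes "u \<in> l2 G c r" "v \<in> l2 G c r" "w \<in> l2 G c r"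
  shows "l2_norm G c r (u - w) \<le> l2_norm G c r (u - v) + l2_norm G c r (v - w)"
proof -
  define h where "h u = case_sum (\<lambda>x. sqrt (c x) * fst u x) (\<lambda>e. sqrt (r e / 2) * snd u e)" for u :: "'v cochain"
  note hs = l2_norm_L2_set[OF _ h_def]
  have hd: "h (u - w) i = h (u - v) i + h (v - w) i" for i
    by (cases i) (simp_all add: h_def algebra_simps)
  have le: "L2_set (h u) F \<le> l2_norm G c r u" if "finite F" "F \<subseteq> pverts G <+> parcs G" "u \<in> l2 G c r" for u F
  proof -
    have "(\<Sum>i\<in>F. (h u i)\<^sup>2) \<le> (l2_norm G c r u)\<^sup>2"
      by (rule has_sum_mono2[OF has_sum_finite[OF that(1)] hs[OF that(3)] that(2)]) auto
    then show ?thesis unfolding L2_set_def by (simp add: l2_norm_nonneg real_le_lsqrt)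
  qed
  have "(l2_norm G c r (u - w))\<^sup>2 \<le> (l2_norm G c r (u - v) + l2_norm G c r (v - w))\<^sup>2"
  proof (rule has_sum_le_finite_sums[OF hs[OF diff_l2[OF assms(1,3)]]])
    fix F :: "('v + 'v \<times> 'v) set" assume F: "finite F" "F \<subseteq> pverts G <+> parcs G"
    have "L2_set (h (u - w)) F \<le> L2_set (h (u - v)) F + L2_set (h (v - w)) F"
      using L2_set_triangle_ineq[of "h (u - v)" "h (v - w)" F] hd
      by (simp cong: L2_set_cong)
    also have "\<dots> \<le> l2_norm G c r (u - v) + l2_norm G c r (v - w)"
      by (intro add_mono le F diff_l2 assms)
    finally show "(\<Sum>i\<in>F. (h (u - w) i)\<^sup>2) \<le> (l2_norm G c r (u - v) + l2_norm G c r (v - w))\<^sup>2"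
      unfolding L2_set_def by (rule sqrt_le_D)
  qed
  then show ?thesis by (rule power2_le_imp_le) (simp add: l2_norm_nonneg)
qed

lemma Metric_space_l2: "Metric_space (l2 G c r) (\<lambda>u v. l2_norm G c r (u - v))"
proof
  fix u v w
  show "0 \<le> l2_norm G c r (u - v)" by (rule l2_norm_nonneg)
  show "l2_norm G c r (u - v) = l2_norm G c r (v - u)"
    by (cases u; cases v) (simp add: power2_commute)
  show "(l2_norm G c r (u - v) = 0) = (u = v)" if "u \<in> l2 G c r" "v \<in> l2 G c r"
  proof
    show "l2_norm G c r (u - v) = 0 \<Longrightarrow> u = v"
      using l2_norm_eq_0[OF diff_l2[OF that]] by simp
    show "u = v \<Longrightarrow> l2_norm G c r (u - v) = 0"
      by (simp add: zero_prod_def)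
  qed
  show "l2_norm G c r (u - w) \<le> l2_norm G c r (u - v) + l2_norm G c r (v - w)"
    if "u \<in> l2 G c r" "v \<in> l2 G c r" "w \<in> l2 G c r"
    using that by (rule l2_norm_triangle)
qed

end

definition l2_topology ::
  "'v pair_pre_digraph \<Rightarrow> ('v \<Rightarrow> real) \<Rightarrow> ('v \<times> 'v \<Rightarrow> real) \<Rightarrow> 'v cochain topology" where
  "l2_topology G c r = Metric_space.mtopology (l2 G c r) (\<lambda>u v. l2_norm G c r (u - v))"


section \<open>The Gauss-Bonnet operator and semi-Fredholm operators\<close>

definition coboundary :: "'v pair_pre_digraph \<Rightarrow> ('v \<Rightarrow> real) \<Rightarrow> 'v \<times> 'v \<Rightarrow> real" where
  "coboundary G f = (\<lambda>e. if e \<in> parcs G then f (snd e) - f (fst e) else 0)"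

definition codifferential ::
  "'v pair_pre_digraph \<Rightarrow> ('v \<Rightarrow> real) \<Rightarrow> ('v \<times> 'v \<Rightarrow> real) \<Rightarrow>
    ('v \<times> 'v \<Rightarrow> real) \<Rightarrow> 'v \<Rightarrow> real" where
  "codifferential G c r \<phi> = (\<lambda>x. 1 / c x * (\<Sum>e\<in>in_arcs (with_proj G) x. r e * \<phi> e))"

fun gauss_bonnet ::
  "'v pair_pre_digraph \<Rightarrow> ('v \<Rightarrow> real) \<Rightarrow> ('v \<times> 'v \<Rightarrow> real) \<Rightarrow> 'v cochain \<Rightarrow> 'v cochain" where
  "gauss_bonnet G c r (f, \<phi>) = (codifferential G c r \<phi>, coboundary G f)"

definition bounded_operator_l2 ::
  "'v pair_pre_digraph \<Rightarrow> ('v \<Rightarrow> real) \<Rightarrow> ('v \<times> 'v \<Rightarrow> real) \<Rightarrow>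
    ('w::real_normed_vector \<Rightarrow> 'v cochain) \<Rightarrow> bool" where
  "bounded_operator_l2 G c r T \<longleftrightarrow>
    linear T \<and> range T \<subseteq> l2 G c r \<and> (\<exists>M. \<forall>w. l2_norm G c r (T w) \<le> M * norm w)"

definition semi_Fredholm_l2 ::
  "'v pair_pre_digraph \<Rightarrow> ('v \<Rightarrow> real) \<Rightarrow> ('v \<times> 'v \<Rightarrow> real) \<Rightarrow>
    ('w::real_normed_vector \<Rightarrow> 'v cochain) \<Rightarrow> bool" where
  "semi_Fredholm_l2 G c r T \<longleftrightarrow>
    bounded_operator_l2 G c r T \<and>
    closedin (l2_topology G c r) (range T) \<and>
    (\<exists>B. finite B \<and> {w. T w = 0} = span B)"

end

theory Submission
  imports Defs
begin

text \<open>Let \<open>M\<close> be the closure in \<open>W\<close> of the finitely supported cochains that vanish on the finite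
  subgraph. By density, the lower bound for the Gauss-Bonnet operator \<open>D\<close> extends to \<open>M\<close>
  (\<open>bounded_below_on_closure\<close>). A finitely supported cochain lies in \<open>M\<close> as soon as finitely many of
  its coordinates vanish, so these cochains are contained in \<open>M + span B\<close> with \<open>B\<close> finite
  (\<open>common_kernel_finite_codim\<close>). The sum of a closed and a finite-dimensional subspace is closed
  (\<open>closed_span_Un_finite\<close>), hence \<open>W = M + span B\<close> by density of the finitely supported cochains.

  The rest is functional analysis. The image of a closed subspace on which \<open>D\<close> is bounded below is
  closed (\<open>image_closed_if_bounded_below\<close>). Therefore, if \<open>D b\<close> is not in \<open>D M\<close>, it has positive
  distance from \<open>D M\<close>, and \<open>D\<close> is still bounded below on \<open>M + span {b}\<close>; if \<open>D b = D m\<close> with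
  \<open>m \<in> M\<close>, then \<open>b\<close> may be replaced by the kernel vector \<open>b - m\<close>. Treating the elements of \<open>B\<close> in
  turn gives \<open>W = M' + span N\<close> with \<open>D\<close> bounded below on the closed subspace \<open>M'\<close> and \<open>N\<close> a finite
  subset of the kernel (\<open>bounded_below_plus_kernel\<close>). Consequently the range of \<open>D\<close> is \<open>D M'\<close>, which
  is closed, and its kernel is \<open>span N\<close>.\<close>


section \<open>Subspaces of finite codimension\<close>

lemma subspace_closure:
  fixes S :: "'a::real_normed_vector set"
  assumes "subspace S"
  shows "subspace (closure S)"
proof (rule subspaceI)
  show "0 \<in> closure S"
    using subspace_0[OF assms] closure_subset by blast
next
  fix x y assume "x \<in> closure S" "y \<in> closure S"
  then obtain f g where "\<forall>n. f n \<in> S" "f \<longlonglongrightarrow> x" "\<forall>n. g n \<in> S" "g \<longlonglongrightarrow> y"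
    by (auto simp: closure_sequential)
  then show "x + y \<in> closure S"
    unfolding closure_sequential
    by (intro exI[of _ "\<lambda>n. f n + g n"]) (auto intro: tendsto_add subspace_add[OF assms])
next
  fix x and a :: real assume "x \<in> closure S"
  then obtain f where "\<forall>n. f n \<in> S" "f \<longlonglongrightarrow> x"
    by (auto simp: closure_sequential)
  then show "a *\<^sub>R x \<in> closure S"
    unfolding closure_sequential
    by (intro exI[of _ "\<lambda>n. a *\<^sub>R f n"])
      (auto intro: tendsto_scaleR tendsto_const subspace_scale[OF assms])
qed

text \<open>For \<open>b\<close> outside \<open>M\<close>, the distance from \<open>b\<close> to \<open>M\<close> is positive, which makes the
  \<open>b\<close>-coefficients of a convergent sequence in \<open>M + span {b}\<close> a Cauchy sequence.\<close>

lemma closed_span_insert: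
  fixes M :: "'a::{real_normed_vector, complete_space} set"
  assumes "closed M" "subspace M"
  shows "closed (span (insert b M))"
proof (cases "b \<in> M")
  case True
  then show ?thesis
    using assms by (simp add: insert_absorb span_eq_iff[THEN iffD2])
next
  case False
  define d where "d = infdist b M"
  have "d > 0"
    unfolding d_def using assms False subspace_0[OF assms(2)]
    by (intro infdist_pos_not_in_closed) auto
  have mem: "x \<in> span (insert b M) \<longleftrightarrow> (\<exists>k. x - k *\<^sub>R b \<in> M)" for x
    using assms(2) by (simp add: span_insert span_eq_iff[THEN iffD2])
  have gap: "d * \<bar>k\<bar> \<le> norm x" if "x - k *\<^sub>R b \<in> M" for x k
  proof (cases "k = 0")
    case k: False
    have "(- 1 / k) *\<^sub>R (x - k *\<^sub>R b) \<in> M"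
      using assms(2) that by (rule subspace_scale)
    then have "d \<le> dist b ((- 1 / k) *\<^sub>R (x - k *\<^sub>R b))"
      unfolding d_def by (rule infdist_le)
    also have "b - (- 1 / k) *\<^sub>R (x - k *\<^sub>R b) = (1 / k) *\<^sub>R x"
      using k by (simp add: algebra_simps)
    then have "dist b ((- 1 / k) *\<^sub>R (x - k *\<^sub>R b)) = norm x / \<bar>k\<bar>"
      by (simp add: dist_norm)
    finally show ?thesis
      using k by (simp add: field_simps)
  qed simp
  show ?thesis
    unfolding closed_sequential_limits
  proof (intro allI impI, elim conjE)
    fix x l
    assume "\<forall>n::nat. x n \<in> span (insert b M)" and lim: "x \<longlonglongrightarrow> l"
    then obtain k where k: "\<And>n. x n - k n *\<^sub>R b \<in> M"
      unfolding mem by metis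
    have kd: "d * \<bar>k i - k j\<bar> \<le> norm (x i - x j)" for i j
      using subspace_diff[OF assms(2) k k, of i j] by (intro gap) (simp add: algebra_simps)
    have "Cauchy k"
    proof (rule metric_CauchyI)
      fix e :: real assume "e > 0"
      then obtain n where n: "\<And>i j. i \<ge> n \<Longrightarrow> j \<ge> n \<Longrightarrow> dist (x i) (x j) < d * e"
        using LIMSEQ_imp_Cauchy[OF lim] \<open>d > 0\<close> by (meson Cauchy_def mult_pos_pos)
      have "dist (k i) (k j) < e" if "i \<ge> n" "j \<ge> n" for i j
      proof -
        have "d * \<bar>k i - k j\<bar> < d * e"
          using kd[of i j] n[OF that] by (simp add: dist_norm)
        then show ?thesis
          using \<open>d > 0\<close> by (simp add: dist_real_def)
      qed
      then show "\<exists>n. \<forall>i\<ge>n. \<forall>j\<ge>n. dist (k i) (k j) < e" by blast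
    qed
    then obtain k0 where "k \<longlonglongrightarrow> k0"
      using Cauchy_convergent_iff convergentD by metis
    then have "(\<lambda>n. x n - k n *\<^sub>R b) \<longlonglongrightarrow> l - k0 *\<^sub>R b"
      by (intro tendsto_intros lim)
    then have "l - k0 *\<^sub>R b \<in> M"
      by (rule closed_sequentially[OF assms(1) k])
    then show "l \<in> span (insert b M)"
      unfolding mem by blast
  qed
qed

lemma closed_span_Un_finite:
  fixes M :: "'a::{real_normed_vector, complete_space} set"
  assumes "finite B" "closed M" "subspace M"
  shows "closed (span (M \<union> B))"
  using assms(1)
proof induction
  case empty
  then show ?case using assms by (simp add: span_eq_iff[THEN iffD2])
next
  case (insert b B)
  have "span (insert b (span (M \<union> B))) = span (M \<union> insert b B)"
    by (rule span_eq[THEN iffD2])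
      (auto intro: span_base span_mono[THEN subsetD, of "M \<union> B"])
  then show ?case
    using closed_span_insert[OF insert.IH subspace_span, of b] by simp
qed

text \<open>The common kernel of finitely many linear functionals has finite codimension: each further
  functional \<open>l\<close> costs at most one vector \<open>b\<close> with \<open>l b \<noteq> 0\<close>, along which the value of \<open>l\<close> can be
  removed.\<close>

lemma common_kernel_finite_codim:
  fixes l :: "'i \<Rightarrow> 'a::real_vector \<Rightarrow> real"
  assumes "finite I" "\<And>i. i \<in> I \<Longrightarrow> linear (l i)" "subspace S"
  shows "\<exists>B. finite B \<and> S \<subseteq> span ({s \<in> S. \<forall>i\<in>I. l i s = 0} \<union> B)"
  using assms(1,2)
proof induction
  case empty
  then show ?case by (intro exI[of _ "{}"]) (auto intro: span_base)
next
  case (insert j I)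
  let ?S0 = "{s \<in> S. \<forall>i\<in>I. l i s = 0}" and ?S1 = "{s \<in> S. \<forall>i\<in>insert j I. l i s = 0}"
  obtain B where B: "finite B" "S \<subseteq> span (?S0 \<union> B)"
    using insert by auto
  have "\<exists>b. ?S0 \<subseteq> span (insert b ?S1)"
  proof (cases "\<exists>b\<in>?S0. l j b \<noteq> 0")
    case True
    then obtain b where b: "b \<in> ?S0" "l j b \<noteq> 0" by blast
    have "s \<in> span (insert b ?S1)" if s: "s \<in> ?S0" for s
    proof -
      let ?t = "l j s / l j b"
      have "l i (s - ?t *\<^sub>R b) = 0" if "i \<in> insert j I" for i
        using insert.prems[OF that] s b that by (auto simp: linear_diff linear_scale)
      then have "s - ?t *\<^sub>R b \<in> ?S1"
        using s b assms(3) by (auto intro!: subspace_diff subspace_scale)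
      then show ?thesis
        unfolding span_insert by (auto intro: span_base)
    qed
    then show ?thesis by blast
  next
    case False
    then have "?S0 \<subseteq> ?S1" by auto
    then show ?thesis
      using span_superset[of "insert 0 ?S1"] by blast
  qed
  then obtain b where "?S0 \<subseteq> span (insert b ?S1)" by blast
  then have "?S0 \<union> B \<subseteq> span (?S1 \<union> insert b B)"
    using span_mono[of "insert b ?S1" "?S1 \<union> insert b B"] by (auto intro: span_base)
  then have "S \<subseteq> span (?S1 \<union> insert b B)"
    using B(2) span_minimal[OF _ subspace_span] by blast
  with B(1) show ?case by (intro exI[of _ "insert b B"]) auto
qed


section \<open>Operators bounded below on a subspace of finite codimension\<close>

text \<open>The target is a subspace \<open>L\<close> of a vector space together with a norm \<open>p\<close> on \<open>L\<close>, so that it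
  can be a space of square-summable functions inside the space of all functions. All
  limits are taken in the domain, which is complete.\<close>

locale bounded_operator_to_subspace =
  fixes L :: "'b::real_vector set" and p :: "'b \<Rightarrow> real"
    and T :: "'a::{real_normed_vector, complete_space} \<Rightarrow> 'b" and bound :: real
  assumes subspace_L: "subspace L"
    and p_add: "x \<in> L \<Longrightarrow> y \<in> L \<Longrightarrow> p (x + y) \<le> p x + p y"
    and p_scale: "x \<in> L \<Longrightarrow> p (a *\<^sub>R x) = \<bar>a\<bar> * p x"
    and p_eq_0: "x \<in> L \<Longrightarrow> p x = 0 \<Longrightarrow> x = 0"
    and linear_T: "linear T"
    and T_in: "T w \<in> L"
    and T_bound: "p (T w) \<le> bound * norm w"
begin

definition bounded_below_on :: "'a set \<Rightarrow> bool" where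
  "bounded_below_on M \<longleftrightarrow> (\<exists>C>0. \<forall>m\<in>M. C * norm m \<le> p (T m))"

lemma p_zero: "p 0 = 0"
  using p_scale[of 0 0] subspace_0[OF subspace_L] by simp

lemma p_minus: "x \<in> L \<Longrightarrow> p (- x) = p x"
  using p_scale[of x "-1"] by simp

lemma p_nonneg: "x \<in> L \<Longrightarrow> 0 \<le> p x"
  using p_add[of x "- x"] subspace_neg[OF subspace_L] by (simp add: p_minus p_zero)

lemma bounded_below_on_closure:
  assumes "bounded_below_on S"
  shows "bounded_below_on (closure S)"
proof -
  obtain C where C: "C > 0" "\<And>m. m \<in> S \<Longrightarrow> C * norm m \<le> p (T m)"
    using assms by (auto simp: bounded_below_on_def)
  have "C * norm m \<le> p (T m)" if "m \<in> closure S" for m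
  proof -
    obtain s where s: "\<And>n. s n \<in> S" "s \<longlonglongrightarrow> m"
      using \<open>m \<in> closure S\<close> by (auto simp: closure_sequential)
    have "C * norm (s n) \<le> p (T m) + bound * norm (s n - m)" for n
    proof -
      have "T (s n) = T m + T (s n - m)"
        by (simp add: linear_diff[OF linear_T])
      then have "p (T (s n)) \<le> p (T m) + p (T (s n - m))"
        using p_add[OF T_in T_in] by metis
      then show ?thesis
        using C(2)[OF s(1)] T_bound[of "s n - m"] by (metis add_left_mono order_trans)
    qed
    moreover have "(\<lambda>n. C * norm (s n)) \<longlonglongrightarrow> C * norm m"
      by (intro tendsto_intros s)
    moreover have "(\<lambda>n. p (T m) + bound * norm (s n - m)) \<longlonglongrightarrow> p (T m) + bound * norm (m - m)"
      by (intro tendsto_intros s)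
    ultimately show ?thesis
      using LIMSEQ_le by fastforce
  qed
  with \<open>C > 0\<close> show ?thesis by (auto simp: bounded_below_on_def)
qed

text \<open>Preimages of a convergent sequence of values form a Cauchy sequence by the lower bound, and
  the limit of the preimages lies in \<open>M\<close>. So the image of \<open>M\<close> is closed in \<open>L\<close>.\<close>

lemma image_closed_if_bounded_below:
  assumes "bounded_below_on M" "closed M" "subspace M" "y \<in> L"
    and approx: "\<And>e. e > 0 \<Longrightarrow> \<exists>m\<in>M. p (y - T m) < e"
  shows "y \<in> T ` M"
proof -
  obtain C where C: "C > 0" "\<And>m. m \<in> M \<Longrightarrow> C * norm m \<le> p (T m)"
    using assms(1) by (auto simp: bounded_below_on_def)
  have "\<exists>m. m \<in> M \<and> p (y - T m) < inverse (real (Suc n))" for n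
    using approx[of "inverse (real (Suc n))"] by auto
  then obtain m where m: "\<And>n. m n \<in> M" "\<And>n. p (y - T (m n)) < inverse (real (Suc n))"
    by metis
  define q where "q n = p (y - T (m n))" for n
  have yL: "y - T w \<in> L" for w
    using assms(4) T_in subspace_diff[OF subspace_L] by blast
  have q0: "q \<longlonglongrightarrow> 0"
    by (rule tendsto_sandwich[OF _ _ tendsto_const LIMSEQ_inverse_real_of_nat])
      (use m(2) p_nonneg[OF yL] in \<open>auto simp: q_def less_imp_le\<close>)
  have diff: "C * norm (m i - m j) \<le> q i + q j" for i j
  proof -
    have "T (m i - m j) = (y - T (m j)) + - (y - T (m i))"
      by (simp add: linear_diff[OF linear_T])
    then have "p (T (m i - m j)) \<le> q j + q i"
      unfolding q_def using p_add[OF yL subspace_neg[OF subspace_L yL]] p_minus[OF yL] by metis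
    then show ?thesis
      using C(2)[OF subspace_diff[OF assms(3) m(1) m(1)], of i j] by simp
  qed
  have "Cauchy m"
  proof (rule metric_CauchyI)
    fix e :: real assume "e > 0"
    then have "eventually (\<lambda>n. q n < C * e / 2) sequentially"
      using q0 \<open>C > 0\<close> by (intro order_tendstoD(2)) auto
    then obtain n where n: "\<And>i. i \<ge> n \<Longrightarrow> q i < C * e / 2"
      by (auto simp: eventually_sequentially)
    have "dist (m i) (m j) < e" if "i \<ge> n" "j \<ge> n" for i j
    proof -
      have "C * norm (m i - m j) < C * e"
        using diff[of i j] n[OF that(1)] n[OF that(2)] by linarith
      then show ?thesis
        using \<open>C > 0\<close> by (simp add: dist_norm)
    qed
    then show "\<exists>n. \<forall>i\<ge>n. \<forall>j\<ge>n. dist (m i) (m j) < e" by blast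
  qed
  then obtain w where w: "m \<longlonglongrightarrow> w"
    using Cauchy_convergent_iff convergentD by metis
  have "w \<in> M"
    using assms(2) m(1) w by (rule closed_sequentially)
  have "p (y - T w) \<le> q n + bound * norm (m n - w)" for n
  proof -
    have "y - T w = (y - T (m n)) + T (m n - w)"
      by (simp add: linear_diff[OF linear_T])
    then have "p (y - T w) \<le> q n + p (T (m n - w))"
      unfolding q_def using p_add[OF yL T_in] by metis
    then show ?thesis
      using T_bound[of "m n - w"] by simp
  qed
  moreover have "(\<lambda>n. q n + bound * norm (m n - w)) \<longlonglongrightarrow> 0 + bound * norm (w - w)"
    by (intro tendsto_intros q0 w)
  ultimately have "p (y - T w) \<le> 0"
    using LIMSEQ_le_const by fastforce
  then have "y - T w = 0"
    using p_nonneg[OF yL] by (intro p_eq_0 yL antisym)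
  with \<open>w \<in> M\<close> show ?thesis by auto
qed

text \<open>The value \<open>T b\<close> has positive distance \<open>d\<close> from the closed image of \<open>M\<close>, so
  \<open>p (T (m + k b))\<close> controls \<open>\<bar>k\<bar>\<close>, and hence also \<open>p (T m)\<close> and \<open>norm m\<close>.\<close>

lemma bounded_below_on_span_insert:
  assumes "bounded_below_on M" "closed M" "subspace M" "T b \<notin> T ` M"
  shows "bounded_below_on (span (insert b M))"
proof -
  obtain C where C: "C > 0" "\<And>m. m \<in> M \<Longrightarrow> C * norm m \<le> p (T m)"
    using assms(1) by (auto simp: bounded_below_on_def)
  obtain d where d: "d > 0" "\<And>m. m \<in> M \<Longrightarrow> d \<le> p (T b - T m)"
    using image_closed_if_bounded_below[OF assms(1-3) T_in[of b]] assms(4)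
    by (meson not_less)
  \<comment> \<open>For \<open>w = m + k b\<close>: \<open>\<bar>k\<bar> \<le> p (T w) / d\<close>, and \<open>C * norm m \<le> p (T m) \<le> p (T w) + \<bar>k\<bar> * p (T b)\<close>.\<close>
  define A where "A = norm b / d + (1 + p (T b) / d) / C"
  have pb: "p (T b) \<ge> 0"
    by (rule p_nonneg[OF T_in])
  have "A \<ge> 0"
    unfolding A_def using C(1) d(1) pb by simp
  have main: "norm w \<le> A * p (T w)" if w: "w \<in> span (insert b M)" for w
  proof -
    obtain k where k: "w - k *\<^sub>R b \<in> M"
      using w assms(3) by (auto simp: span_insert span_eq_iff[THEN iffD2])
    define m where "m = w - k *\<^sub>R b"
    have m: "m \<in> M" and wm: "w = m + k *\<^sub>R b"
      using k by (auto simp: m_def)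
    have pw: "p (T w) \<ge> 0"
      by (rule p_nonneg[OF T_in])
    have kd: "d * \<bar>k\<bar> \<le> p (T w)"
    proof (cases "k = 0")
      case False
      have "d \<le> p (T b - T ((- 1 / k) *\<^sub>R m))"
        using subspace_scale[OF assms(3) m] by (rule d(2))
      also have "T b - T ((- 1 / k) *\<^sub>R m) = (1 / k) *\<^sub>R T w"
        using False by (simp add: wm linear_add[OF linear_T] linear_scale[OF linear_T]
            scaleR_add_right linear_neg[OF linear_T])
      also have "p \<dots> = p (T w) / \<bar>k\<bar>"
        by (simp add: p_scale[OF T_in])
      finally show ?thesis
        using False by (simp add: field_simps)
    qed (use pw in simp)
    have k_le: "\<bar>k\<bar> \<le> p (T w) / d"
      using kd d(1) by (simp add: field_simps)
    have "T m = T w + (- k) *\<^sub>R T b"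
      by (simp add: wm linear_add[OF linear_T] linear_scale[OF linear_T])
    then have "p (T m) \<le> p (T w) + \<bar>k\<bar> * p (T b)"
      using p_add[OF T_in subspace_scale[OF subspace_L T_in]] p_scale[OF T_in] by (metis abs_minus)
    also have "\<dots> \<le> p (T w) + p (T w) / d * p (T b)"
      by (intro add_left_mono mult_right_mono k_le pb)
    finally have "C * norm m \<le> (1 + p (T b) / d) * p (T w)"
      using C(2)[OF m] by (simp add: algebra_simps)
    then have "norm m \<le> (1 + p (T b) / d) / C * p (T w)"
      using C(1) by (simp add: field_simps)
    moreover have "\<bar>k\<bar> * norm b \<le> norm b / d * p (T w)"
      using mult_right_mono[OF k_le norm_ge_zero[of b]] by (simp add: field_simps)
    moreover have "norm w \<le> norm m + \<bar>k\<bar> * norm b"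
      unfolding wm using norm_triangle_ineq[of m "k *\<^sub>R b"] by simp
    ultimately show ?thesis
      unfolding A_def by (simp add: algebra_simps)
  qed
  have "inverse (A + 1) * norm w \<le> p (T w)" if "w \<in> span (insert b M)" for w
  proof -
    have "norm w \<le> (A + 1) * p (T w)"
      using main[OF that] p_nonneg[OF T_in, of w] by (simp add: algebra_simps)
    then show ?thesis
      using \<open>A \<ge> 0\<close> by (simp add: field_simps)
  qed
  moreover have "inverse (A + 1) > 0"
    using \<open>A \<ge> 0\<close> by simp
  ultimately show ?thesis
    unfolding bounded_below_on_def by blast
qed

text \<open>The finitely many missing directions are added one at a time. A direction whose value is new
  enlarges the subspace \<open>M\<close>; any other direction \<open>b\<close> has \<open>T b = T m\<close> with \<open>m\<close> in that subspace,
  and contributes the kernel vector \<open>b - m\<close> instead.\<close>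

lemma bounded_below_plus_kernel:
  assumes "finite B" "bounded_below_on M" "closed M" "subspace M"
  shows "\<exists>M' N. bounded_below_on M' \<and> closed M' \<and> subspace M' \<and>
    finite N \<and> (\<forall>n\<in>N. T n = 0) \<and> span (M \<union> B) \<subseteq> span (M' \<union> N)"
  using assms(1)
proof induction
  case empty
  show ?case
    using assms by (intro exI[of _ M] exI[of _ "{}"]) auto
next
  case (insert b B)
  then obtain M' N where M': "bounded_below_on M'" "closed M'" "subspace M'"
    and N: "finite N" "\<forall>n\<in>N. T n = 0" and sub: "span (M \<union> B) \<subseteq> span (M' \<union> N)"
    by blast
  have extend: "span (M \<union> insert b B) \<subseteq> span X" if "M' \<union> N \<subseteq> span X" "b \<in> span X" for X
  proof (rule span_minimal[OF _ subspace_span])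
    have "M \<union> B \<subseteq> span (M' \<union> N)"
      using sub span_superset by blast
    also have "\<dots> \<subseteq> span X"
      using that(1) by (rule span_minimal[OF _ subspace_span])
    finally show "M \<union> insert b B \<subseteq> span X"
      using that(2) by blast
  qed
  show ?case
  proof (cases "T b \<in> T ` M'")
    case True
    then obtain m where m: "m \<in> M'" "T b = T m" by blast
    have "(b - m) + m \<in> span (M' \<union> insert (b - m) N)"
      using m(1) by (intro span_add span_base) auto
    then have "span (M \<union> insert b B) \<subseteq> span (M' \<union> insert (b - m) N)"
      by (intro extend) (auto intro: span_base)
    moreover have "T (b - m) = 0"
      using m(2) by (simp add: linear_diff[OF linear_T])
    ultimately show ?thesis
      using M' N by (intro exI[of _ M'] exI[of _ "insert (b - m) N"]) auto
  next
    case False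
    have "span (M \<union> insert b B) \<subseteq> span (span (insert b M') \<union> N)"
      by (intro extend) (auto intro: span_base)
    then show ?thesis
      using bounded_below_on_span_insert[OF M' False] closed_span_insert[OF M'(2,3), of b] N
      by (intro exI[of _ "span (insert b M')"] exI[of _ N]) auto
  qed
qed

text \<open>The subspace \<open>L\<close> carries no topology here, so closedness of the range is expressed by
  approximation in \<open>p\<close>.\<close>

lemma semi_Fredholm_if_bounded_below_finite_codim:
  assumes "bounded_below_on M" "closed M" "subspace M" "finite B"
    and dense: "closure (span (M \<union> B)) = UNIV"
  shows "\<exists>N. finite N \<and> {w. T w = 0} = span N"
    and "\<And>y. y \<in> L \<Longrightarrow> (\<And>e. e > 0 \<Longrightarrow> \<exists>w. p (y - T w) < e) \<Longrightarrow> y \<in> range T"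
proof -
  obtain M' N where M': "bounded_below_on M'" "closed M'" "subspace M'"
    and N: "finite N" "\<forall>n\<in>N. T n = 0" and sub: "span (M \<union> B) \<subseteq> span (M' \<union> N)"
    using bounded_below_plus_kernel[OF assms(4,1,2,3)] by blast
  have "span (M \<union> B) = UNIV"
    using dense closed_span_Un_finite[OF assms(4,2,3)] by simp
  then have "span (M' \<union> N) = UNIV"
    using sub by blast
  then have decomp: "\<exists>m n. w = m + n \<and> m \<in> M' \<and> n \<in> span N" for w
    using span_Un[of M' N] span_eq_iff[THEN iffD2, OF M'(3)] by blast
  have kerN: "T n = 0" if "n \<in> span N" for n
    using linear_eq_0_on_span[OF linear_T] N(2) that by blast
  have inj: "m = 0" if m: "m \<in> M'" "T m = 0" for m
  proof -
    obtain C where "C > 0" "C * norm m \<le> p (T m)"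
      using M'(1) m(1) by (auto simp: bounded_below_on_def)
    then show ?thesis
      by (simp add: m(2) p_zero mult_le_0_iff)
  qed
  have "w \<in> span N" if "T w = 0" for w
  proof -
    obtain m n where "w = m + n" "m \<in> M'" "n \<in> span N"
      using decomp by blast
    then show ?thesis
      using inj[of m] kerN[of n] that by (auto simp: linear_add[OF linear_T])
  qed
  then show "\<exists>N. finite N \<and> {w. T w = 0} = span N"
    using N(1) kerN by (intro exI[of _ N]) auto
  fix y assume y: "y \<in> L" and approx: "\<And>e. e > 0 \<Longrightarrow> \<exists>w. p (y - T w) < e"
  have "\<exists>m\<in>M'. p (y - T m) < e" if "e > 0" for e
  proof -
    obtain w where w: "p (y - T w) < e"
      using approx[OF \<open>e > 0\<close>] by blast
    obtain m n where "w = m + n" "m \<in> M'" "n \<in> span N"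
      using decomp by blast
    with w show ?thesis
      using kerN[of n] by (auto simp: linear_add[OF linear_T])
  qed
  then have "y \<in> T ` M'"
    by (rule image_closed_if_bounded_below[OF M' y])
  then show "y \<in> range T" by blast
qed

end


section \<open>Square-summable and finitely supported cochains\<close>

lemma subspace_finitely_supported:
  fixes A :: "'b set"
  shows "subspace {f :: 'b \<Rightarrow> real. finite {x. f x \<noteq> 0} \<and> {x. f x \<noteq> 0} \<subseteq> A}"
proof (rule subspaceI; clarify)
  fix f g :: "'b \<Rightarrow> real" and a :: real
  assume f: "finite {x. f x \<noteq> 0}" "{x. f x \<noteq> 0} \<subseteq> A"
  have "{x. (a *\<^sub>R f) x \<noteq> 0} \<subseteq> {x. f x \<noteq> 0}" by auto
  then show "finite {x. (a *\<^sub>R f) x \<noteq> 0} \<and> {x. (a *\<^sub>R f) x \<noteq> 0} \<subseteq> A"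
    using f finite_subset by blast
  assume g: "finite {x. g x \<noteq> 0}" "{x. g x \<noteq> 0} \<subseteq> A"
  have "{x. (f + g) x \<noteq> 0} \<subseteq> {x. f x \<noteq> 0} \<union> {x. g x \<noteq> 0}" by auto
  then show "finite {x. (f + g) x \<noteq> 0} \<and> {x. (f + g) x \<noteq> 0} \<subseteq> A"
    using f g finite_subset[OF _ finite_UnI[OF f(1) g(1)]] by blast
qed auto

lemma subspace_skew: "subspace {\<phi> :: 'b \<times> 'b \<Rightarrow> real. \<forall>e\<in>E. \<phi> (prod.swap e) = - \<phi> e}"
  by (rule subspaceI) auto

lemma subspace_image_linear_on:
  assumes "linear_on S f" "subspace S" "S' \<subseteq> S" "subspace S'"
  shows "subspace (f ` S')"
proof -
  have "f 0 = 0"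
    using assms(1) subspace_0[OF assms(2)] unfolding linear_on_def by (metis scale_zero_left)
  moreover have "f u + f v \<in> f ` S'" if "u \<in> S'" "v \<in> S'" for u v
    using assms(1,3) that subspace_add[OF assms(4) that]
    by (intro image_eqI[of _ _ "u + v"]) (simp_all add: linear_on_def subset_iff)
  moreover have "a *\<^sub>R f u \<in> f ` S'" if "u \<in> S'" for a u
    using assms(1,3) that subspace_scale[OF assms(4) that]
    by (intro image_eqI[of _ _ "a *\<^sub>R u"]) (simp_all add: linear_on_def subset_iff)
  ultimately show ?thesis
    using subspace_0[OF assms(4)] by (auto simp: subspace_def intro: image_eqI[of _ _ 0])
qed

context weighted_graph
begin

lemma l2_norm_scaleR: "l2_norm G c r (a *\<^sub>R u) = \<bar>a\<bar> * l2_norm G c r u"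
proof -
  obtain f \<phi> where u: "u = (f, \<phi>)" by fastforce
  have eq: "k * (a * t)\<^sup>2 = a\<^sup>2 * (k * t\<^sup>2)" for k t :: real
    by (simp add: power_mult_distrib)
  have "(\<Sum>\<^sub>\<infinity>x\<in>pverts G. c x * (a * f x)\<^sup>2) = a\<^sup>2 * (\<Sum>\<^sub>\<infinity>x\<in>pverts G. c x * (f x)\<^sup>2)"
    "(\<Sum>\<^sub>\<infinity>e\<in>parcs G. r e * (a * \<phi> e)\<^sup>2) = a\<^sup>2 * (\<Sum>\<^sub>\<infinity>e\<in>parcs G. r e * (\<phi> e)\<^sup>2)"
    unfolding eq by (simp_all only: infsum_cmult_right')
  then have "l2_norm G c r (a *\<^sub>R u) = sqrt (a\<^sup>2 * (l2_norm G c r u)\<^sup>2)"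
    using l2_norm_nonneg[of u] by (simp add: u algebra_simps)
  then show ?thesis
    using l2_norm_nonneg[of u] by (simp add: real_sqrt_mult)
qed

lemma subspace_l2: "subspace (l2 G c r)"
proof -
  have zero: "0 \<in> l2 G c r"
    by (auto simp: l2_def cochains_def vertex_functions_def edge_functions_def zero_prod_def)
  have summable: "(\<lambda>x. k x * (a * f x)\<^sup>2) summable_on A"
    if "(\<lambda>x. k x * (f x)\<^sup>2) summable_on A" for k f :: "'c \<Rightarrow> real" and a A
    using summable_on_cmult_right[OF that, of "a\<^sup>2"]
    by (simp add: power_mult_distrib mult.left_commute)
  have scale: "a *\<^sub>R u \<in> l2 G c r" if "u \<in> l2 G c r" for a u
    using that
    by (cases u) (auto simp: l2_def cochains_def vertex_functions_def edge_functions_def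
        intro: summable)
  have "u + v \<in> l2 G c r" if "u \<in> l2 G c r" "v \<in> l2 G c r" for u v
    using diff_l2[OF that(1) scale[OF that(2), of "-1"]] by simp
  with zero scale show ?thesis
    by (simp add: subspace_def)
qed

lemma l2_norm_add:
  assumes "u \<in> l2 G c r" "v \<in> l2 G c r"
  shows "l2_norm G c r (u + v) \<le> l2_norm G c r u + l2_norm G c r v"
  using l2_norm_triangle[of u 0 "- v"] assms subspace_0[OF subspace_l2]
    subspace_neg[OF subspace_l2] by simp

lemma subspace_cochains0_outside: "subspace (cochains0_outside G K)"
proof -
  have "vertex_functions0 G (pverts G - K) =
    {f. finite {x. f x \<noteq> 0} \<and> {x. f x \<noteq> 0} \<subseteq> pverts G - K}"
    by (auto simp: vertex_functions0_def vertex_functions_def)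
  moreover have "edge_functions0 G (parcs G - edges_within G K) =
    {\<phi>. finite {e. \<phi> e \<noteq> 0} \<and> {e. \<phi> e \<noteq> 0} \<subseteq> parcs G - edges_within G K} \<inter>
    {\<phi>. \<forall>e\<in>parcs G. \<phi> (prod.swap e) = - \<phi> e}"
    by (auto simp: edge_functions0_def edge_functions_def)
  ultimately show ?thesis
    unfolding cochains0_outside_def
    by (simp only:) (intro subspace_Times subspace_inter subspace_finitely_supported subspace_skew)
qed

lemma cochains0_eq_outside_empty: "cochains0 G = cochains0_outside G {}"
  by (auto simp: cochains0_def cochains0_outside_def edges_within_def)

lemma finite_edges_within: "finite K \<Longrightarrow> finite (edges_within G K)"
  by (rule finite_subset[of _ "K \<times> K"]) (auto simp: edges_within_def)

lemma cochains0_outsideI: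
  assumes "u \<in> cochains0 G" "\<forall>x\<in>K. fst u x = 0" "\<forall>e\<in>edges_within G K. snd u e = 0"
  shows "u \<in> cochains0_outside G K"
  using assms by (auto simp: cochains0_def cochains0_outside_def vertex_functions0_def edge_functions0_def)

end


section \<open>The semi-Fredholm property of the Gauss-Bonnet operator\<close>

theorem proposition4p1:
  fixes G :: "'v pair_pre_digraph"
    and c :: "'v \<Rightarrow> real"
    and r :: "'v \<times> 'v \<Rightarrow> real"
    and \<iota> :: "'v cochain \<Rightarrow> 'w::{real_inner, complete_space}"
    and D :: "'w \<Rightarrow> 'v cochain"
  assumes "weighted_graph G c r"
    and "Digraph_Component.connected (with_proj G)"
    and "locally_finite_graph G"
    and "linear_on (cochains0 G) \<iota>"
    and "inj_on \<iota> (cochains0 G)"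
    and "closure (\<iota> ` cochains0 G) = UNIV"
    and "\<exists>J :: 'w \<Rightarrow> 'v cochain. linear J \<and> inj J \<and> continuous_on UNIV J \<and>
          range J \<subseteq> cochains G \<and> (\<forall>u\<in>cochains0 G. J (\<iota> u) = u)"
    and "bounded_operator_l2 G c r D"
    and "\<forall>u\<in>cochains0 G. D (\<iota> u) = gauss_bonnet G c r u"
    and "\<exists>K C. finite K \<and> K \<subseteq> pverts G \<and> C > 0 \<and>
          (\<forall>u\<in>cochains0_outside G K. C * norm (\<iota> u) \<le> l2_norm G c r (gauss_bonnet G c r u))"
  shows "semi_Fredholm_l2 G c r D"
proof -
  interpret weighted_graph G c r by fact
  obtain J :: "'w \<Rightarrow> 'v cochain" where J: "linear J" "\<And>u. u \<in> cochains0 G \<Longrightarrow> J (\<iota> u) = u"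
    using assms(7) by blast
  obtain b where D: "linear D" "\<And>w. D w \<in> l2 G c r" "\<And>w. l2_norm G c r (D w) \<le> b * norm w"
    using assms(8) by (auto simp: bounded_operator_l2_def)
  obtain K C where K: "finite K" "C > 0"
    and below: "\<And>u. u \<in> cochains0_outside G K \<Longrightarrow>
      C * norm (\<iota> u) \<le> l2_norm G c r (gauss_bonnet G c r u)"
    using assms(10) by blast
  interpret T: bounded_operator_to_subspace "l2 G c r" "l2_norm G c r" D b
    by (rule bounded_operator_to_subspace.intro)
      (rule subspace_l2 l2_norm_add l2_norm_scaleR l2_norm_eq_0 D; assumption)+

  have outside: "cochains0_outside G K \<subseteq> cochains0 G"
    by (auto simp: cochains0_def cochains0_outside_def vertex_functions0_def edge_functions0_def)
  have sub0: "subspace (cochains0 G)"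
    unfolding cochains0_eq_outside_empty by (rule subspace_cochains0_outside)
  define M where "M = closure (\<iota> ` cochains0_outside G K)"
  have M: "closed M" "subspace M"
    unfolding M_def
    using subspace_image_linear_on[OF assms(4) sub0 outside subspace_cochains0_outside]
    by (auto intro: subspace_closure)
  have "T.bounded_below_on (\<iota> ` cochains0_outside G K)"
    unfolding T.bounded_below_on_def
  proof (intro exI[of _ C] conjI ballI K(2))
    fix w assume "w \<in> \<iota> ` cochains0_outside G K"
    then obtain u where u: "u \<in> cochains0_outside G K" "w = \<iota> u" by blast
    then have "D w = gauss_bonnet G c r u"
      using outside assms(9) by blast
    then show "C * norm w \<le> l2_norm G c r (D w)"
      using below[OF u(1)] u(2) by (simp only:)
  qed
  then have M_below: "T.bounded_below_on M"
    unfolding M_def by (rule T.bounded_below_on_closure)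

  \<comment> \<open>The coordinates at the vertices and edges of the finite subgraph, as functionals on all of
    \<open>'w\<close>: the embedding \<open>J\<close> into functions makes them available there.\<close>
  define l :: "'v + 'v \<times> 'v \<Rightarrow> 'w \<Rightarrow> real"
    where "l i w = case_sum (fst (J w)) (snd (J w)) i" for i w
  have l_linear: "linear (l i)" for i
    by (rule linearI; cases i) (simp_all add: l_def linear_add[OF J(1)] linear_scale[OF J(1)])
  have "\<exists>B. finite B \<and> \<iota> ` cochains0 G \<subseteq>
    span ({s \<in> \<iota> ` cochains0 G. \<forall>i\<in>K <+> edges_within G K. l i s = 0} \<union> B)"
    by (rule common_kernel_finite_codim)
      (rule finite_Plus K(1) finite_edges_within l_linear
        subspace_image_linear_on[OF assms(4) sub0 order_refl sub0])+
  then obtain B where B: "finite B"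
    "\<iota> ` cochains0 G \<subseteq> span ({s \<in> \<iota> ` cochains0 G. \<forall>i\<in>K <+> edges_within G K. l i s = 0} \<union> B)"
    by (elim exE conjE)
  have "{s \<in> \<iota> ` cochains0 G. \<forall>i\<in>K <+> edges_within G K. l i s = 0} \<subseteq> M"
  proof clarify
    fix u assume u: "u \<in> cochains0 G" and z: "\<forall>i\<in>K <+> edges_within G K. l i (\<iota> u) = 0"
    have "u \<in> cochains0_outside G K"
    proof (rule cochains0_outsideI[OF u])
      show "\<forall>x\<in>K. fst u x = 0"
        using z[rule_format, OF InlI] by (simp add: l_def J(2)[OF u])
      show "\<forall>e\<in>edges_within G K. snd u e = 0"
        using z[rule_format, OF InrI] by (simp add: l_def J(2)[OF u])
    qed
    then show "\<iota> u \<in> M"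
      unfolding M_def by (intro subsetD[OF closure_subset] imageI)
  qed
  then have "\<iota> ` cochains0 G \<subseteq> span (M \<union> B)"
    by (intro order_trans[OF B(2)] span_mono Un_mono order_refl)
  from closure_mono[OF this] have "closure (span (M \<union> B)) = UNIV"
    unfolding assms(6) by (rule top.extremum_uniqueI)
  note F = T.semi_Fredholm_if_bounded_below_finite_codim[OF M_below M B(1) this]

  interpret Metric: Metric_space "l2 G c r" "\<lambda>u v. l2_norm G c r (u - v)"
    by (rule Metric_space_l2)
  have "closedin (l2_topology G c r) (range D)"
    unfolding l2_topology_def Metric.closedin_metric
  proof (intro conjI allI impI)
    show "range D \<subseteq> l2 G c r"
      using D(2) by blast
    fix y assume y: "y \<in> l2 G c r - range D"
    then obtain e where e: "e > 0" "\<And>w. \<not> l2_norm G c r (y - D w) < e"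
      using F(2)[of y] by (metis DiffD1 DiffD2)
    then show "\<exists>e>0. disjnt (range D) (Metric.mball y e)"
      by (intro exI[of _ e]) (auto simp: disjnt_def Metric.in_mball)
  qed
  then show ?thesis
    using assms(8) F(1) by (simp add: semi_Fredholm_l2_def)
qed

end
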